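(* Let $m<n$, let $X\in\mathbb{C}^{m\times n}$ have full row rank, and let $y\in\mathbb{C}^m$. Let $\beta_{LN}=\arg\min\{\|\beta\|_2 : X\beta=y\}$ be the least Euclidean norm solution of $X\beta=y$. For every integer $T\ge 1$, the output $\beta^{LN}_T$ of the Randomized Extended Gauss-Seidel (REGS) algorithm (defined in the context) run for $T$ iterations on input $X,y$ satisfies $$\mathbb{E}\,\|\beta^{LN}_T-\beta_{LN}\|_2^2\;\le\;\alpha^T\,\|\beta_{LN}\|_2^2+2\,\alpha^{\lfloor T/2\rfloor}\,\frac{B}{1-\alpha},$$ where $$B=\frac{\|X\beta_{LN}\|_2^2}{\|X\|_F^2},\qquad \alpha=1-\frac{\sigma_{\min}^2(X)}{\|X\|_F^2}.$$
   Context: Notation: $X^i$ is the $i$th row of $X$ (a row vector), $X_{(j)}$ is the $j$th column of $X$, $e_{(j)}\in\mathbb{C}^n$ is the $j$th standard basis column vector, $A^*$ is the conjugate transpose of $A$, $\|X\|_F$ is the Frobenius norm, $\sigma_{\min}(X)$ is the smallest nonzero singular value of $X$, and $I_n$ is the $n\times n$ identity matrix. The convention $\alpha^0=1$ is used. REGS algorithm on input $X$, $y$, $T$: initialize $\beta_0=0\in\mathbb{C}^n$ and $z_0=0\in\mathbb{C}^n$. For $t=1,2,\dots,T$: (1) choose a random column index $j=j_t\in\{1,\dots,n\}$ with $\Pr(j_t=j)=\|X_{(j)}\|_2^2/\|X\|_F^2$; (2) choose a random row index $i=i_t\in\{1,\dots,m\}$ with $\Pr(i_t=i)=\|X^i\|_2^2/\|X\|_F^2$;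 (3) set $\gamma_t=-\dfrac{X_{(j)}^*(X\beta_{t-1}-y)}{\|X_{(j)}\|_2^2}\,e_{(j)}$; (4) set $\beta_t=\beta_{t-1}+\gamma_t$; (5) set $P_i=I_n-\dfrac{(X^i)^*X^i}{\|X^i\|_2^2}$; (6) set $z_t=P_i(z_{t-1}+\gamma_t)$; (7) set $\beta^{LN}_t=\beta_t-z_t$. Output $\beta^{LN}_T$. All random choices (rows and columns, across all iterations) are mutually independent, and $\mathbb{E}$ is the expectation over all of them. *)

theory Defs
  imports "HOL-Probability.Probability"
begin

text \<open>
  Complex \<open>m \<times> n\<close> matrices are of type \<^typ>\<open>complex ^ 'n ^ 'm\<close>. On vectors, \<open>norm\<close> is the
  Euclidean norm. Rows are represented as vectors; conjugation is written out where it is needed.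
\<close>

section \<open>Linear algebra\<close>

definition conj_transpose :: "complex ^ 'n ^ 'm \<Rightarrow> complex ^ 'm ^ 'n" where
  "conj_transpose A = (\<chi> i j. cnj (A $ j $ i))"

text \<open>The scalar \<open>u\<^sup>* v\<close>, conjugate linear in the first argument.\<close>

definition cdot :: "complex ^ 'm \<Rightarrow> complex ^ 'm \<Rightarrow> complex" where
  "cdot u v = (\<Sum>i\<in>UNIV. cnj (u $ i) * v $ i)"

definition frobenius_norm :: "complex ^ 'n ^ 'm \<Rightarrow> real" where
  "frobenius_norm A = sqrt (\<Sum>i\<in>UNIV. \<Sum>j\<in>UNIV. (cmod (A $ i $ j))\<^sup>2)"

text \<open>The singular values of \<open>A\<close> are the nonnegative square roots of the eigenvalues of \<open>A\<^sup>* A\<close>.\<close>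

definition singular_value :: "complex ^ 'n ^ 'm \<Rightarrow> real \<Rightarrow> bool" where
  "singular_value A s \<longleftrightarrow>
     0 \<le> s \<and> (\<exists>v. v \<noteq> 0 \<and> (conj_transpose A ** A) *v v = complex_of_real (s\<^sup>2) *s v)"

text \<open>The smallest nonzero singular value (meaningful for \<open>A \<noteq> 0\<close>).\<close>

definition sigma_min :: "complex ^ 'n ^ 'm \<Rightarrow> real" where
  "sigma_min A = (LEAST s. singular_value A s \<and> s \<noteq> 0)"

definition full_row_rank :: "complex ^ 'n ^ 'm \<Rightarrow> bool" where
  "full_row_rank A \<longleftrightarrow> rank A = CARD('m)"

definition least_norm_solution :: "complex ^ 'n ^ 'm \<Rightarrow> complex ^ 'm \<Rightarrow> complex ^ 'n" where
  "least_norm_solution X y = (ARG_MIN norm \<beta>. X *v \<beta> = y)"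

section \<open>The randomized extended Gauss-Seidel algorithm\<close>

text \<open>
  The sampling weights sum to one exactly when \<open>X \<noteq> 0\<close>; only then are the two
  distributions below meaningful.
\<close>

definition column_pmf :: "complex ^ 'n ^ 'm \<Rightarrow> 'n pmf" where
  "column_pmf X = embed_pmf (\<lambda>j. (norm (column j X))\<^sup>2 / (frobenius_norm X)\<^sup>2)"

definition row_pmf :: "complex ^ 'n ^ 'm \<Rightarrow> 'm pmf" where
  "row_pmf X = embed_pmf (\<lambda>i. (norm (row i X))\<^sup>2 / (frobenius_norm X)\<^sup>2)"

lemma frobenius_norm_nonzero: "X \<noteq> 0 \<Longrightarrow> frobenius_norm X > 0"
proof -
  assume "X \<noteq> 0"
  then obtain i j where "X $ i $ j \<noteq> 0"
    by (auto simp: vec_eq_iff)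
  then have "0 < (\<Sum>j\<in>UNIV. (cmod (X $ i $ j))\<^sup>2)"
    by (intro sum_pos2[of _ j]) auto
  then have "0 < (\<Sum>i\<in>UNIV. \<Sum>j\<in>UNIV. (cmod (X $ i $ j))\<^sup>2)"
    by (intro sum_pos2[of _ i]) (auto intro: sum_nonneg)
  then show ?thesis
    by (simp add: frobenius_norm_def)
qed

lemma norm_vec_complex_sq: "(norm (v :: complex ^ 'k))\<^sup>2 = (\<Sum>i\<in>UNIV. (cmod (v $ i))\<^sup>2)"
  by (simp add: norm_vec_def L2_set_def sum_nonneg)

lemma frobenius_norm_sq_rows: "(frobenius_norm X)\<^sup>2 = (\<Sum>i\<in>UNIV. (norm (row i X))\<^sup>2)"
  by (simp add: frobenius_norm_def norm_vec_complex_sq row_def sum_nonneg)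

lemma frobenius_norm_sq_columns: "(frobenius_norm X)\<^sup>2 = (\<Sum>j\<in>UNIV. (norm (column j X))\<^sup>2)"
  unfolding frobenius_norm_sq_rows
  by (simp add: norm_vec_complex_sq row_def column_def) (rule sum.swap)

lemma pmf_column_pmf:
  assumes "X \<noteq> 0"
  shows "pmf (column_pmf X) j = (norm (column j X))\<^sup>2 / (frobenius_norm X)\<^sup>2"
  unfolding column_pmf_def using frobenius_norm_nonzero[OF assms]
  by (intro pmf_embed_pmf)
     (simp_all add: nn_integral_count_space_finite sum_ennreal
        flip: sum_divide_distrib frobenius_norm_sq_columns)

lemma pmf_row_pmf:
  assumes "X \<noteq> 0"
  shows "pmf (row_pmf X) i = (norm (row i X))\<^sup>2 / (frobenius_norm X)\<^sup>2"
  unfolding row_pmf_def using frobenius_norm_nonzero[OF assms]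
  by (intro pmf_embed_pmf)
     (simp_all add: nn_integral_count_space_finite sum_ennreal
        flip: sum_divide_distrib frobenius_norm_sq_rows)

text \<open>
  The update \<open>\<gamma>\<close> for column index \<open>j\<close>. A zero column is drawn with probability \<open>0\<close>, so
  division by zero is immaterial here and below.
\<close>

definition regs_gamma ::
  "complex ^ 'n ^ 'm \<Rightarrow> complex ^ 'm \<Rightarrow> 'n \<Rightarrow> complex ^ 'n \<Rightarrow> complex ^ 'n" where
  "regs_gamma X y j \<beta> =
     - (cdot (column j X) (X *v \<beta> - y) / complex_of_real ((norm (column j X))\<^sup>2)) *s axis j 1"

text \<open>\<open>P\<^sub>i = I - (X\<^sup>i)\<^sup>* X\<^sup>i / \<parallel>X\<^sup>i\<parallel>\<^sup>2\<close>, the outer product being given entrywise.\<close>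

definition row_projection :: "complex ^ 'n ^ 'm \<Rightarrow> 'm \<Rightarrow> complex ^ 'n ^ 'n" where
  "row_projection X i =
     mat 1 - (\<chi> k l. cnj (row i X $ k) * row i X $ l / complex_of_real ((norm (row i X))\<^sup>2))"

text \<open>One iteration on the pair \<open>(\<beta>, z)\<close> with column index \<open>j\<close> and row index \<open>i\<close>.\<close>

definition regs_step ::
  "complex ^ 'n ^ 'm \<Rightarrow> complex ^ 'm \<Rightarrow> 'n \<Rightarrow> 'm \<Rightarrow>
     (complex ^ 'n) \<times> (complex ^ 'n) \<Rightarrow> (complex ^ 'n) \<times> (complex ^ 'n)" where
  "regs_step X y j i = (\<lambda>(\<beta>, z).
     let \<gamma> = regs_gamma X y j \<beta>
     in (\<beta> + \<gamma>, row_projection X i *v (z + \<gamma>)))"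

text \<open>
  The joint distribution of \<open>(\<beta>\<^sub>t, z\<^sub>t)\<close>. Each iteration draws a fresh column and a fresh row
  in the probability monad, so all draws are mutually independent.
\<close>

primrec regs ::
  "complex ^ 'n ^ 'm \<Rightarrow> complex ^ 'm \<Rightarrow> nat \<Rightarrow> ((complex ^ 'n) \<times> (complex ^ 'n)) pmf" where
  "regs X y 0 = return_pmf (0, 0)"
| "regs X y (Suc t) =
     bind_pmf (regs X y t) (\<lambda>s.
     bind_pmf (column_pmf X) (\<lambda>j.
     bind_pmf (row_pmf X) (\<lambda>i.
     return_pmf (regs_step X y j i s))))"

definition regs_output :: "complex ^ 'n ^ 'm \<Rightarrow> complex ^ 'm \<Rightarrow> nat \<Rightarrow> (complex ^ 'n) pmf" where
  "regs_output X y T = map_pmf (\<lambda>(\<beta>, z). \<beta> - z) (regs X y T)"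

end

theory Submission
  imports Defs
begin

text \<open>
  Let \<open>L\<close> be the least norm solution, \<open>Q\<^sub>i = I - P\<^sub>i\<close> and \<open>e\<^sub>t = \<beta>\<^sub>t - z\<^sub>t - L\<close>. Then
  \<open>e\<^sub>t = P\<^sub>i e\<^sub>t\<^sub>-\<^sub>1 + Q\<^sub>i (\<beta>\<^sub>t - L)\<close> is an orthogonal sum that stays in the row space of \<open>X\<close>.
  In expectation the first part shrinks the squared norm by \<open>\<alpha>\<close>, and the second has squared norm
  \<open>\<parallel>X \<beta>\<^sub>t - y\<parallel>\<^sup>2 / \<parallel>X\<parallel>\<^sub>F\<^sup>2\<close>, which the column steps bound by \<open>\<alpha>\<^sup>t B\<close>. Unrolling the recursion
  gives \<open>\<alpha>\<^sup>T \<parallel>L\<parallel>\<^sup>2 + T \<alpha>\<^sup>T B\<close>, and \<open>T \<alpha>\<^sup>T\<close> is compared with a geometric series of length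
  \<open>\<lceil>T/2\<rceil>\<close>. All orthogonality is taken for the real inner product, which suffices because the
  conjugate transpose is also the real adjoint.
\<close>

section \<open>Row space and singular values\<close>

lemma inner_vec_complex: "inner u v = Re (cdot u v)"
  by (simp add: inner_vec_def inner_complex_def cdot_def)

lemma inner_conj_transpose:
  "inner (A *v x) y = inner x (conj_transpose A *v y)"
proof -
  have "cdot (A *v x) y = (\<Sum>i\<in>UNIV. \<Sum>j\<in>UNIV. cnj (A $ i $ j) * cnj (x $ j) * y $ i)"
    by (simp add: cdot_def matrix_vector_mult_def cnj_sum sum_distrib_right)
  also have "\<dots> = (\<Sum>j\<in>UNIV. \<Sum>i\<in>UNIV. cnj (A $ i $ j) * cnj (x $ j) * y $ i)"
    by (rule sum.swap)
  also have "\<dots> = cdot x (conj_transpose A *v y)"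
    by (simp add: cdot_def matrix_vector_mult_def conj_transpose_def sum_distrib_left mult_ac)
  finally show ?thesis
    by (simp add: inner_vec_complex)
qed

lemma conj_transpose_conj_transpose [simp]: "conj_transpose (conj_transpose A) = A"
  by (simp add: conj_transpose_def vec_eq_iff)

text \<open>Columns of the conjugate transpose are the conjugated rows, so this is the orthogonal
  complement of the kernel of \<open>A\<close>, which in general differs from the span of
  \<open>rows A\<close>.\<close>

definition row_space :: "complex ^ 'n ^ 'm \<Rightarrow> (complex ^ 'n) set" where
  "row_space A = range ((*v) (conj_transpose A))"

lemma subspace_row_space: "subspace (row_space A)"
  unfolding row_space_def by (intro linear_subspace_image subspace_UNIV) simp

lemma conj_transpose_in_row_space [simp]: "conj_transpose A *v u \<in> row_space A"
  by (simp add: row_space_def)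

text \<open>Test against \<open>w = conj_transpose A *v (A *v z)\<close>: the inner product is then
  the squared norm of \<open>A *v z\<close>.\<close>

lemma orthogonal_row_space_imp_kernel:
  assumes "\<And>w. w \<in> row_space A \<Longrightarrow> inner z w = 0"
  shows "A *v z = 0"
proof -
  have "inner (A *v z) (A *v z) = 0"
    unfolding inner_conj_transpose by (rule assms) simp
  then show ?thesis by simp
qed

lemma kernel_orthogonal_row_space:
  assumes "A *v z = 0" "w \<in> row_space A"
  shows "inner z w = 0"
  using assms by (auto simp: row_space_def simp flip: inner_conj_transpose)

lemma row_space_decomp:
  obtains e k where "e \<in> row_space A" "A *v k = 0" "x = e + k"
proof -
  obtain e k where "e \<in> span (row_space A)"
    and "\<And>w. w \<in> span (row_space A) \<Longrightarrow> orthogonal k w" and "x = e + k"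
    using orthogonal_subspace_decomp_exists by blast
  moreover have "span (row_space A) = row_space A"
    using subspace_row_space by (simp add: span_eq_iff)
  ultimately show thesis
    using that orthogonal_row_space_imp_kernel[of A k] by (simp add: orthogonal_def)
qed

lemma row_space_inter_kernel:
  assumes "e \<in> row_space A" "A *v e = 0"
  shows "e = 0"
  using kernel_orthogonal_row_space[OF assms(2,1)] by simp

lemma row_space_nontrivial:
  assumes "A \<noteq> 0"
  shows "row_space A \<noteq> {0}"
proof
  assume *: "row_space A = {0}"
  have "A *v x = 0" for x
    by (rule orthogonal_row_space_imp_kernel) (simp add: *)
  then have "A = 0"
    by (simp add: matrix_eq)
  with assms show False ..
qed

section \<open>The smallest nonzero singular value as a lower bound on the row space\<close>

lemma singular_value_iff:
  fixes A :: "complex ^ 'n ^ 'm"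
  shows "singular_value A s \<longleftrightarrow>
     0 \<le> s \<and> (\<exists>v. v \<noteq> 0 \<and> conj_transpose A *v (A *v v) = s\<^sup>2 *\<^sub>R v)"
proof -
  have "complex_of_real r *s v = r *\<^sub>R v" for r and v :: "complex ^ 'n"
    by (simp add: vec_eq_iff) (simp add: scaleR_conv_of_real)
  then show ?thesis
    by (simp add: singular_value_def matrix_vector_mul_assoc del: of_real_power)
qed

text \<open>An eigenvector for a nonzero eigenvalue is a multiple of an image under the conjugate
  transpose, hence in the row space, and its Rayleigh quotient is \<open>s^2\<close>.\<close>

lemma singular_value_lower_bound:
  assumes lb: "\<And>e. e \<in> row_space A \<Longrightarrow> c\<^sup>2 * (norm e)\<^sup>2 \<le> (norm (A *v e))\<^sup>2"
    and "singular_value A s" "s \<noteq> 0"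
  shows "c \<le> s"
proof -
  obtain v where s: "0 \<le> s" and v: "v \<noteq> 0" "conj_transpose A *v (A *v v) = s\<^sup>2 *\<^sub>R v"
    using assms(2) unfolding singular_value_iff by blast
  have "(1 / s\<^sup>2) *\<^sub>R (conj_transpose A *v (A *v v)) \<in> row_space A"
    using subspace_row_space by (intro subspace_scale) simp_all
  then have "v \<in> row_space A"
    using \<open>s \<noteq> 0\<close> by (simp add: v)
  have "(norm (A *v v))\<^sup>2 = inner v (conj_transpose A *v (A *v v))"
    by (simp only: power2_norm_eq_inner inner_conj_transpose)
  also have "\<dots> = s\<^sup>2 * (norm v)\<^sup>2"
    by (simp add: v power2_norm_eq_inner)
  finally have "c\<^sup>2 * (norm v)\<^sup>2 \<le> s\<^sup>2 * (norm v)\<^sup>2"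
    using lb[OF \<open>v \<in> row_space A\<close>] by simp
  then have "c\<^sup>2 \<le> s\<^sup>2"
    using v(1) by simp
  then show "c \<le> s"
    using s by (rule power2_le_imp_le)
qed

text \<open>
  A minimiser of the Rayleigh quotient on the row space satisfies the eigenvalue equation,
  because its first variation vanishes and \<open>A\<^sup>* A\<close> maps the row space to itself.
\<close>

lemma rayleigh_minimiser_eigenvector:
  assumes lb: "\<And>e. e \<in> row_space A \<Longrightarrow> c * (norm e)\<^sup>2 \<le> (norm (A *v e))\<^sup>2"
    and v: "v \<in> row_space A" "(norm (A *v v))\<^sup>2 = c * (norm v)\<^sup>2"
  shows "conj_transpose A *v (A *v v) = c *\<^sub>R v"
proof -
  define d where "d = conj_transpose A *v (A *v v) - c *\<^sub>R v"
  have d: "d \<in> row_space A"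
    unfolding d_def using subspace_row_space v(1)
    by (intro subspace_diff subspace_scale) simp_all
  define q where "q = (norm (A *v d))\<^sup>2 - c * (norm d)\<^sup>2"
  \<comment> \<open>Apply the bound at \<open>v + t *\<^sub>R d\<close>. The constant term cancels
    because \<open>v\<close> attains equality, and the linear coefficient is the squared norm of
    \<open>d\<close> because \<open>d\<close> is half the gradient at \<open>v\<close>.\<close>
  have ineq: "0 \<le> 2 * t * (norm d)\<^sup>2 + t\<^sup>2 * q" for t
  proof -
    have "v + t *\<^sub>R d \<in> row_space A"
      using subspace_row_space v(1) d by (intro subspace_add subspace_scale)
    from lb[OF this] have "0 \<le> (norm (A *v v + t *\<^sub>R (A *v d)))\<^sup>2 - c * (norm (v + t *\<^sub>R d))\<^sup>2"
      by (simp add: matrix_vector_right_distrib linear_scale[OF matrix_vector_mul_linear])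
    also have "\<dots> = 2 * t * (inner (A *v d) (A *v v) - c * inner d v) + t\<^sup>2 * q"
      using v(2) unfolding power2_norm_eq_inner q_def
      by (simp add: inner_add_left inner_add_right inner_commute algebra_simps power2_eq_square)
    also have "inner (A *v d) (A *v v) - c * inner d v = (norm d)\<^sup>2"
      by (simp add: inner_conj_transpose power2_norm_eq_inner d_def inner_diff_right)
    finally show ?thesis .
  qed
  have "norm d = 0"
  proof (rule ccontr)
    assume "norm d \<noteq> 0"
    define n where "n = (norm d)\<^sup>2"
    have n: "n > 0" using \<open>norm d \<noteq> 0\<close> by (simp add: n_def)
    \<comment> \<open>A negative step this short keeps the quadratic term below the linear one, so
      \<open>2 * n + t * q\<close> stays positive.\<close>
    define t where "t = - n / (\<bar>q\<bar> + 1)"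
    have t: "t < 0" using n by (simp add: t_def divide_neg_pos)
    have "0 \<le> t * (2 * n + t * q)"
      using ineq[of t] by (simp add: n_def power2_eq_square algebra_simps)
    then have "2 * n + t * q \<le> 0"
      using t by (simp add: zero_le_mult_iff)
    moreover have "\<bar>t * q\<bar> \<le> n"
    proof -
      have "\<bar>t * q\<bar> = n * (\<bar>q\<bar> / (\<bar>q\<bar> + 1))"
        using n by (simp add: t_def abs_mult)
      also have "\<dots> \<le> n * 1"
        using n by (intro mult_left_mono) auto
      finally show ?thesis by simp
    qed
    ultimately show False using n by linarith
  qed
  then show ?thesis by (simp add: d_def)
qed

text \<open>By compactness \<open>norm (A *v v)\<close> attains its minimum \<open>c\<close> on the
  unit sphere of the row space. The minimiser is an eigenvector, so \<open>c\<close> is a singular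
  value, and no nonzero singular value is smaller; this also shows that the \<open>LEAST\<close> is
  attained. Positivity holds because the row space meets the kernel only in 0.\<close>

lemma sigma_min_pos_and_bound:
  assumes "A \<noteq> 0"
  shows "sigma_min A > 0 \<and>
    (\<forall>e \<in> row_space A. (sigma_min A)\<^sup>2 * (norm e)\<^sup>2 \<le> (norm (A *v e))\<^sup>2)"
proof -
  define S where "S = row_space A \<inter> sphere 0 1"
  have normalise: "e /\<^sub>R norm e \<in> S" if "e \<in> row_space A" "e \<noteq> 0" for e
    using that subspace_row_space[of A] by (simp add: S_def subspace_scale)
  obtain e0 where "e0 \<in> row_space A" "e0 \<noteq> 0"
    using row_space_nontrivial[OF assms] subspace_0[OF subspace_row_space[of A]] by blast
  then have "S \<noteq> {}"
    using normalise by blast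
  moreover have "compact S"
    unfolding S_def using closed_subspace[OF subspace_row_space] by (intro closed_Int_compact) simp_all
  moreover have "continuous_on S (\<lambda>v. norm (A *v v))"
    by (intro continuous_intros)
  ultimately obtain v where v: "v \<in> S" and min: "\<And>w. w \<in> S \<Longrightarrow> norm (A *v v) \<le> norm (A *v w)"
    using continuous_attains_inf by metis
  define c where "c = norm (A *v v)"
  have v': "v \<in> row_space A" "norm v = 1"
    using v by (simp_all add: S_def)
  then have "v \<noteq> 0" by auto
  then have "c > 0"
    using row_space_inter_kernel[OF v'(1)] by (auto simp: c_def)
  have lb: "c\<^sup>2 * (norm e)\<^sup>2 \<le> (norm (A *v e))\<^sup>2" if "e \<in> row_space A" for e
  proof (cases "e = 0")
    case False
    have "c \<le> norm (A *v (e /\<^sub>R norm e))"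
      unfolding c_def by (rule min[OF normalise[OF that False]])
    also have "\<dots> = norm (A *v e) / norm e"
      by (simp add: linear_scale[OF matrix_vector_mul_linear] divide_inverse mult.commute)
    finally have "c * norm e \<le> norm (A *v e)"
      using False by (simp add: field_simps)
    then show ?thesis
      using \<open>c > 0\<close> by (simp add: power_mono flip: power_mult_distrib)
  qed simp
  have "singular_value A c"
    unfolding singular_value_iff
    using rayleigh_minimiser_eigenvector[OF lb v'(1)] v'(2) \<open>c > 0\<close> \<open>v \<noteq> 0\<close>
    by (auto simp: c_def)
  then have "sigma_min A = c"
    unfolding sigma_min_def using \<open>c > 0\<close> singular_value_lower_bound[OF lb]
    by (intro Least_equality) auto
  then show ?thesis
    using \<open>c > 0\<close> lb by simp
qed

section \<open>Consequences of full row rank\<close>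

text \<open>Conjugating \<open>conj_transpose A *v u = 0\<close> gives a linear relation among the
  rows with coefficients \<open>cnj (u $ i)\<close>, and the rows are independent.\<close>

lemma full_row_rank_inj_conj_transpose:
  fixes A :: "complex ^ 'n ^ 'm"
  assumes "full_row_rank A" "conj_transpose A *v u = 0"
  shows "u = 0"
proof -
  have rows_eq: "rows A = range (\<lambda>i. row i A)"
    by (auto simp: rows_def)
  have fin: "finite (rows A)"
    by (simp add: rows_eq)
  have dim: "vec.dim (rows A) = CARD('m)"
    using assms(1) by (simp add: full_row_rank_def row_rank_def_gen)
  have "card (rows A) \<le> CARD('m)"
    unfolding rows_eq by (rule card_image_le) simp
  with vec.dim_le_card'[OF fin] dim have card: "card (rows A) = CARD('m)"
    by simp
  \<comment> \<open>\<open>rows A\<close> is a set, so equal rows would collapse; the rank forces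
    them to be distinct.\<close>
  then have inj: "inj (\<lambda>i. row i A)"
    unfolding rows_eq by (intro eq_card_imp_inj_on) simp_all
  have indep: "vec.independent (rows A)"
    using fin dim card by (intro vec.card_le_dim_spanning[of _ "rows A"]) (auto intro: vec.span_base)
  \<comment> \<open>Independence of a set needs coefficients indexed by the vectors themselves;
    injectivity allows reading off the row index.\<close>
  define f where "f w = cnj (u $ inv (\<lambda>i. row i A) w)" for w
  have "(\<Sum>w\<in>rows A. f w *s w) = (\<Sum>i\<in>UNIV. cnj (u $ i) *s row i A)"
    unfolding rows_eq by (simp add: sum.reindex[OF inj] f_def inv_f_f[OF inj])
  also have "\<dots> = 0"
  proof -
    have "(\<Sum>i\<in>UNIV. cnj (u $ i) * A $ i $ l) = cnj ((conj_transpose A *v u) $ l)" for l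
      by (simp add: matrix_vector_mult_def conj_transpose_def cnj_sum mult.commute)
    then show ?thesis
      by (simp add: vec_eq_iff row_def assms(2))
  qed
  finally have "f w = 0" if "w \<in> rows A" for w
    using vec.independentD[OF indep fin subset_refl _ that] by blast
  then have "f (row i A) = 0" for i
    by (simp add: rows_eq)
  then have "cnj (u $ i) = 0" for i
    by (simp add: f_def inv_f_f[OF inj])
  then show ?thesis
    by (simp add: vec_eq_iff)
qed

text \<open>Decompose \<open>r\<close> with respect to \<open>conj_transpose A\<close>, whose row
  space is the range of \<open>A\<close> and whose kernel is trivial. Dropping the kernel part of a
  preimage then moves it into the row space.\<close>

lemma full_row_rank_surj:
  assumes "full_row_rank A"
  obtains e where "e \<in> row_space A" "A *v e = r"
proof -
  obtain f k where "f \<in> row_space (conj_transpose A)" "conj_transpose A *v k = 0" "r = f + k"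
    by (rule row_space_decomp)
  moreover from this have "k = 0"
    using full_row_rank_inj_conj_transpose[OF assms] by blast
  ultimately obtain x where "r = A *v x"
    by (auto simp: row_space_def)
  moreover obtain e l where "e \<in> row_space A" "A *v l = 0" "x = e + l"
    by (rule row_space_decomp)
  ultimately show thesis
    using that by (simp add: matrix_vector_right_distrib)
qed

text \<open>Any solution differs from the row space solution \<open>e\<close> by a kernel vector,
  which is orthogonal to \<open>e\<close>. By Pythagoras \<open>e\<close> is the unique shortest
  solution, so the choice in \<open>ARG_MIN\<close> must return it.\<close>

lemma least_norm_solution_full_row_rank:
  assumes "full_row_rank A"
  shows "A *v least_norm_solution A y = y" "least_norm_solution A y \<in> row_space A"
proof -
  obtain e where e: "e \<in> row_space A" "A *v e = y"
    using full_row_rank_surj[OF assms] .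
  have norm: "(norm b)\<^sup>2 = (norm e)\<^sup>2 + (norm (b - e))\<^sup>2" if "A *v b = y" for b
  proof -
    have "inner (b - e) e = 0"
      using that e by (intro kernel_orthogonal_row_space[of A]) (simp_all add: matrix_vector_mult_diff_distrib)
    then show ?thesis
      by (simp add: power2_norm_eq_inner inner_diff_left inner_diff_right inner_commute)
  qed
  have le: "norm e \<le> norm b" if "A *v b = y" for b
    using norm[OF that] by (auto intro: power2_le_imp_le)
  have "least_norm_solution A y = e"
    unfolding least_norm_solution_def
  proof (rule arg_minI[where P = "\<lambda>\<beta>. A *v \<beta> = y"])
    fix b assume b: "A *v b = y" "\<forall>x. A *v x = y \<longrightarrow> \<not> norm x < norm b"
    then have "norm b = norm e"
      using le[OF b(1)] e(2) by force
    then show "b = e"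
      using norm[OF b(1)] by simp
  qed (use e le in \<open>auto simp: not_less\<close>)
  then show "A *v least_norm_solution A y = y" "least_norm_solution A y \<in> row_space A"
    using e by simp_all
qed

lemma full_row_rank_nonzero:
  assumes "full_row_rank A"
  shows "A \<noteq> 0"
proof
  assume "A = 0"
  then have "conj_transpose A *v axis undefined 1 = 0"
    by (simp add: conj_transpose_def matrix_vector_mult_def vec_eq_iff)
  then have "axis undefined (1 :: complex) = (0 :: complex ^ 'b)"
    by (rule full_row_rank_inj_conj_transpose[OF assms])
  then show False by simp
qed

text \<open>Duality carries the row space bound over to the conjugate transpose: write
  \<open>r = A *v e\<close> with \<open>norm e\<close> at most \<open>norm r / \<sigma>\<close>, and
  apply Cauchy-Schwarz to \<open>inner e (conj_transpose A *v r)\<close>, the squared norm of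
  \<open>r\<close>. The column steps need this form.\<close>

lemma sigma_min_conj_transpose_bound:
  assumes "full_row_rank A"
  shows "(sigma_min A)\<^sup>2 * (norm r)\<^sup>2 \<le> (norm (conj_transpose A *v r))\<^sup>2"
proof (cases "r = 0")
  case False
  define \<sigma> where "\<sigma> = sigma_min A"
  obtain e where e: "e \<in> row_space A" "A *v e = r"
    using full_row_rank_surj[OF assms] .
  have \<sigma>: "\<sigma> > 0" "\<sigma>\<^sup>2 * (norm e)\<^sup>2 \<le> (norm r)\<^sup>2"
    using sigma_min_pos_and_bound[OF full_row_rank_nonzero[OF assms]] e by (auto simp: \<sigma>_def)
  have *: "\<sigma> * norm e \<le> norm r"
    using \<sigma>(2) by (rule power2_le_imp_le[OF _ norm_ge_zero, of "\<sigma> * norm e", unfolded power_mult_distrib])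
  have "(norm r)\<^sup>2 = inner e (conj_transpose A *v r)"
    by (simp add: power2_norm_eq_inner e(2) flip: inner_conj_transpose)
  also have "\<dots> \<le> norm e * norm (conj_transpose A *v r)"
    by (rule norm_cauchy_schwarz)
  finally have "\<sigma> * (norm r)\<^sup>2 \<le> (\<sigma> * norm e) * norm (conj_transpose A *v r)"
    using \<sigma>(1) by simp
  also have "\<dots> \<le> norm r * norm (conj_transpose A *v r)"
    using * by (rule mult_right_mono) simp
  finally have "\<sigma> * norm r \<le> norm (conj_transpose A *v r)"
    using False by (simp add: power2_eq_square)
  then show ?thesis
    using \<sigma>(1) by (simp add: \<sigma>_def power_mono flip: power_mult_distrib)
qed simp

section \<open>Row projections\<close>

text \<open>The orthogonal projection onto the conjugate of row \<open>i\<close>, called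
  \<open>Q\<close> in the overview, written as an image of the conjugate transpose so that the
  adjoint identity applies. It is 0 for a zero row.\<close>

definition row_component :: "complex ^ 'n ^ 'm \<Rightarrow> 'm \<Rightarrow> complex ^ 'n \<Rightarrow> complex ^ 'n" where
  "row_component A i v =
     conj_transpose A *v axis i ((A *v v) $ i / complex_of_real ((norm (row i A))\<^sup>2))"

lemma row_component_in_row_space [simp]: "row_component A i v \<in> row_space A"
  by (simp add: row_component_def)

lemma conj_transpose_axis_nth: "(conj_transpose A *v axis i c) $ k = cnj (A $ i $ k) * c"
  by (simp add: matrix_vector_mult_def conj_transpose_def axis_def if_distrib
      cong: if_cong)

lemma row_projection_mult: "row_projection A i *v v = v - row_component A i v"
proof -
  have "(\<chi> k l. cnj (row i A $ k) * row i A $ l / complex_of_real ((norm (row i A))\<^sup>2)) *v v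
      = row_component A i v"
    by (simp add: vec_eq_iff row_component_def conj_transpose_axis_nth)
       (simp add: matrix_vector_mult_def row_def sum_distrib_left sum_divide_distrib mult_ac)
  then show ?thesis
    by (simp add: row_projection_def matrix_vector_mult_diff_rdistrib)
qed

lemma row_projection_in_row_space:
  "v \<in> row_space A \<Longrightarrow> row_projection A i *v v \<in> row_space A"
  by (simp add: row_projection_mult subspace_diff[OF subspace_row_space])

lemma mult_conj_transpose_axis_nth:
  "(A *v (conj_transpose A *v axis i c)) $ i = complex_of_real ((norm (row i A))\<^sup>2) * c"
proof -
  have "(A *v (conj_transpose A *v axis i c)) $ i = (\<Sum>k\<in>UNIV. A $ i $ k * (cnj (A $ i $ k) * c))"
    unfolding matrix_vector_mult_def[of A] by (simp add: conj_transpose_axis_nth)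
  also have "\<dots> = (\<Sum>k\<in>UNIV. complex_of_real ((cmod (A $ i $ k))\<^sup>2) * c)"
    by (intro sum.cong refl) (simp add: complex_norm_square mult_ac del: of_real_power)
  finally show ?thesis
    by (simp add: norm_vec_complex_sq row_def sum_distrib_right)
qed

lemma mult_nth_zero_row:
  assumes "row i A = 0"
  shows "(A *v v) $ i = 0"
  using assms by (simp add: row_def vec_eq_iff matrix_vector_mult_def)

lemma mult_row_projection_nth: "(A *v (row_projection A i *v v)) $ i = 0"
proof (cases "row i A = 0")
  case False
  then show ?thesis
    by (simp add: row_projection_mult row_component_def matrix_vector_mult_diff_distrib
        mult_conj_transpose_axis_nth)
qed (rule mult_nth_zero_row)

lemma norm_row_component:
  "(norm (row_component A i v))\<^sup>2 = (cmod ((A *v v) $ i))\<^sup>2 / (norm (row i A))\<^sup>2"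
proof -
  define c where "c = (A *v v) $ i / complex_of_real ((norm (row i A))\<^sup>2)"
  have "(norm (row_component A i v))\<^sup>2 = inner (A *v (conj_transpose A *v axis i c)) (axis i c)"
    by (simp add: power2_norm_eq_inner row_component_def c_def inner_conj_transpose)
  also have "\<dots> = (norm (row i A))\<^sup>2 * (cmod c)\<^sup>2"
    unfolding cmod_power2
    by (simp add: inner_axis mult_conj_transpose_axis_nth inner_complex_def power2_eq_square
        algebra_simps)
  also have "\<dots> = (cmod ((A *v v) $ i))\<^sup>2 / (norm (row i A))\<^sup>2"
    by (simp add: c_def norm_divide norm_mult norm_power power_divide power2_eq_square)
  finally show ?thesis .
qed

text \<open>Moving the conjugate transpose across the inner product leaves coordinate
  \<open>i\<close> of \<open>A *v (row_projection A i *v a)\<close>, which vanishes. Hence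
  \<open>a\<close> and \<open>b\<close> may be unrelated.\<close>

lemma norm_row_projection_plus_row_component:
  "(norm (row_projection A i *v a + row_component A i b))\<^sup>2 =
     (norm (row_projection A i *v a))\<^sup>2 + (norm (row_component A i b))\<^sup>2"
proof -
  have "inner (row_projection A i *v a) (row_component A i b) = 0"
    by (simp add: row_component_def inner_axis mult_row_projection_nth flip: inner_conj_transpose)
  then show ?thesis
    by (simp add: power2_norm_eq_inner inner_add_left inner_add_right inner_commute)
qed

lemma norm_row_projection:
  "(norm (row_projection A i *v a))\<^sup>2 = (norm a)\<^sup>2 - (norm (row_component A i a))\<^sup>2"
  using norm_row_projection_plus_row_component[of A i a a] by (simp add: row_projection_mult)

text \<open>The sampling weight cancels the squared row norm in the denominator; for a zero row both
  sides of the termwise identity vanish.\<close>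

lemma expectation_norm_row_component:
  assumes "A \<noteq> 0"
  shows "measure_pmf.expectation (row_pmf A) (\<lambda>i. (norm (row_component A i b))\<^sup>2) =
           (norm (A *v b))\<^sup>2 / (frobenius_norm A)\<^sup>2"
proof -
  have "(norm (row_component A i b))\<^sup>2 * pmf (row_pmf A) i
      = (cmod ((A *v b) $ i))\<^sup>2 / (frobenius_norm A)\<^sup>2" for i
    using mult_nth_zero_row[of i A b]
    by (cases "row i A = 0") (simp_all add: norm_row_component pmf_row_pmf[OF assms])
  moreover have "measure_pmf.expectation (row_pmf A) (\<lambda>i. (norm (row_component A i b))\<^sup>2) =
      (\<Sum>i\<in>UNIV. (norm (row_component A i b))\<^sup>2 * pmf (row_pmf A) i)"
    by (rule integral_measure_pmf_real) simp_all
  ultimately show ?thesis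
    by (simp add: norm_vec_complex_sq[of "A *v b"] sum_divide_distrib)
qed

lemma expectation_norm_row_projection_plus_row_component:
  assumes "A \<noteq> 0"
  shows "measure_pmf.expectation (row_pmf A)
           (\<lambda>i. (norm (row_projection A i *v a + row_component A i b))\<^sup>2) =
         (norm a)\<^sup>2 - (norm (A *v a))\<^sup>2 / (frobenius_norm A)\<^sup>2
           + (norm (A *v b))\<^sup>2 / (frobenius_norm A)\<^sup>2"
  unfolding norm_row_projection_plus_row_component norm_row_projection
  by (simp add: integrable_measure_pmf_finite expectation_norm_row_component[OF assms])

lemma expectation_norm_row_projection:
  assumes "A \<noteq> 0"
  shows "measure_pmf.expectation (row_pmf A) (\<lambda>i. (norm (row_projection A i *v a))\<^sup>2) =
         (norm a)\<^sup>2 - (norm (A *v a))\<^sup>2 / (frobenius_norm A)\<^sup>2"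
proof -
  have "row_component A i 0 = 0" for i
    by (simp add: row_component_def vec_eq_iff conj_transpose_axis_nth)
  then show ?thesis
    using expectation_norm_row_projection_plus_row_component[OF assms, of a 0] by simp
qed

section \<open>Column steps through the conjugate transpose\<close>

lemma norm_row_conj_transpose: "norm (row j (conj_transpose A)) = norm (column j A)"
  by (simp add: norm_vec_def row_def column_def conj_transpose_def)

lemma frobenius_norm_conj_transpose: "frobenius_norm (conj_transpose A) = frobenius_norm A"
  unfolding frobenius_norm_def conj_transpose_def by simp (rule sum.swap)

text \<open>Lets the expectation lemmas for row projections serve the column steps as well.\<close>

lemma column_pmf_eq: "column_pmf A = row_pmf (conj_transpose A)"
  by (simp add: column_pmf_def row_pmf_def norm_row_conj_transpose frobenius_norm_conj_transpose)

text \<open>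
  A column step is a row projection for the conjugate transpose, acting on the residual.
\<close>

lemma residual_regs_gamma:
  "X *v (\<beta> + regs_gamma X y j \<beta>) - y = row_projection (conj_transpose X) j *v (X *v \<beta> - y)"
proof -
  have "cdot (column j X) r = (conj_transpose X *v r) $ j" for r
    by (simp add: cdot_def column_def matrix_vector_mult_def conj_transpose_def)
  moreover have "- c *s axis j 1 = - axis j c" for c :: complex
    by (simp add: vec_eq_iff axis_def)
  ultimately have "regs_gamma X y j \<beta> =
      - axis j ((conj_transpose X *v (X *v \<beta> - y)) $ j / complex_of_real ((norm (column j X))\<^sup>2))"
    by (simp only: regs_gamma_def)
  then have "X *v regs_gamma X y j \<beta> = - row_component (conj_transpose X) j (X *v \<beta> - y)"
    by (simp only: row_component_def norm_row_conj_transpose conj_transpose_conj_transpose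
        linear_neg[OF matrix_vector_mul_linear])
  then show ?thesis
    by (simp add: row_projection_mult matrix_vector_right_distrib)
qed

section \<open>Expected progress of one iteration\<close>

lemma expectation_bind_finite:
  fixes h :: "'b \<Rightarrow> real"
  assumes "finite (set_pmf p)" "\<And>x. x \<in> set_pmf p \<Longrightarrow> finite (set_pmf (K x))"
  shows "measure_pmf.expectation (bind_pmf p K) h =
           measure_pmf.expectation p (\<lambda>x. measure_pmf.expectation (K x) h)"
  by (subst pmf_expectation_bind[where A = "set_pmf p"], use assms in simp_all)
     (subst integral_measure_pmf[where A = "set_pmf p"], use assms in simp_all)

text \<open>One transition of the Markov chain of pairs, named so that expectations can be
  conditioned on the current state.\<close>

definition regs_kernel ::
  "complex ^ 'n ^ 'm \<Rightarrow> complex ^ 'm \<Rightarrow> (complex ^ 'n) \<times> (complex ^ 'n)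
     \<Rightarrow> ((complex ^ 'n) \<times> (complex ^ 'n)) pmf" where
  "regs_kernel X y s =
     bind_pmf (column_pmf X) (\<lambda>j. bind_pmf (row_pmf X) (\<lambda>i. return_pmf (regs_step X y j i s)))"

lemma regs_Suc: "regs X y (Suc t) = bind_pmf (regs X y t) (regs_kernel X y)"
  by (simp add: regs_kernel_def[abs_def])

lemma finite_set_regs_kernel: "finite (set_pmf (regs_kernel X y s))"
  by (simp add: regs_kernel_def)

lemma finite_set_regs: "finite (set_pmf (regs X y t))"
  by (induction t) (simp_all del: regs.simps(2) add: regs_Suc finite_set_regs_kernel)

lemma expectation_regs_kernel:
  fixes h :: "_ \<Rightarrow> real"
  shows "measure_pmf.expectation (regs_kernel X y s) h =
    measure_pmf.expectation (column_pmf X) (\<lambda>j.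
      measure_pmf.expectation (row_pmf X) (\<lambda>i. h (regs_step X y j i s)))"
  by (simp add: regs_kernel_def expectation_bind_finite)

lemma expectation_regs_Suc:
  fixes h :: "_ \<Rightarrow> real"
  shows "measure_pmf.expectation (regs X y (Suc t)) h =
    measure_pmf.expectation (regs X y t) (\<lambda>s. measure_pmf.expectation (regs_kernel X y s) h)"
  unfolding regs_Suc by (intro expectation_bind_finite finite_set_regs finite_set_regs_kernel)

section \<open>Contraction and recursions for residual and error\<close>

locale regs_analysis =
  fixes X :: "complex ^ 'n ^ 'm" and y :: "complex ^ 'm"
  assumes full_rank: "full_row_rank X"
begin

definition L where "L = least_norm_solution X y"
definition \<alpha> where "\<alpha> = 1 - (sigma_min X)\<^sup>2 / (frobenius_norm X)\<^sup>2"

definition residual :: "(complex ^ 'n) \<times> (complex ^ 'n) \<Rightarrow> complex ^ 'm" where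
  "residual s = X *v fst s - y"

definition err :: "(complex ^ 'n) \<times> (complex ^ 'n) \<Rightarrow> complex ^ 'n" where
  "err s = fst s - snd s - L"

lemma X_nonzero: "X \<noteq> 0"
  using full_rank by (rule full_row_rank_nonzero)

lemma frobenius_pos: "frobenius_norm X > 0"
  by (intro frobenius_norm_nonzero X_nonzero)

lemma X_L: "X *v L = y" and L_row_space: "L \<in> row_space X"
  unfolding L_def by (intro least_norm_solution_full_row_rank full_rank)+

lemma contraction_row_space:
  assumes "e \<in> row_space X"
  shows "(norm e)\<^sup>2 - (norm (X *v e))\<^sup>2 / (frobenius_norm X)\<^sup>2 \<le> \<alpha> * (norm e)\<^sup>2"
proof -
  have "(sigma_min X)\<^sup>2 * (norm e)\<^sup>2 \<le> (norm (X *v e))\<^sup>2"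
    using sigma_min_pos_and_bound[OF X_nonzero] assms by blast
  then show ?thesis
    using frobenius_pos by (simp add: \<alpha>_def left_diff_distrib divide_right_mono)
qed

lemma contraction_residual:
  "(norm r)\<^sup>2 - (norm (conj_transpose X *v r))\<^sup>2 / (frobenius_norm X)\<^sup>2 \<le> \<alpha> * (norm r)\<^sup>2"
  using sigma_min_conj_transpose_bound[OF full_rank, of r] frobenius_pos
  by (simp add: \<alpha>_def left_diff_distrib divide_right_mono)

lemma \<alpha>_less_1: "\<alpha> < 1"
  using sigma_min_pos_and_bound[OF X_nonzero] frobenius_pos by (simp add: \<alpha>_def)

text \<open>The expected squared norm of a projected nonzero row space vector is nonnegative and at
  most \<open>\<alpha>\<close> times its squared norm.\<close>

lemma \<alpha>_nonneg: "0 \<le> \<alpha>"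
proof -
  obtain e where e: "e \<in> row_space X" "e \<noteq> 0"
    using row_space_nontrivial[OF X_nonzero] subspace_0[OF subspace_row_space[of X]] by blast
  have "0 \<le> measure_pmf.expectation (row_pmf X) (\<lambda>i. (norm (row_projection X i *v e))\<^sup>2)"
    by simp
  also have "\<dots> \<le> \<alpha> * (norm e)\<^sup>2"
    unfolding expectation_norm_row_projection[OF X_nonzero] by (rule contraction_row_space[OF e(1)])
  finally show ?thesis
    using e(2) by (simp add: zero_le_mult_iff)
qed

lemma residual_step:
  "residual (regs_step X y j i s) = row_projection (conj_transpose X) j *v residual s"
  by (cases s) (simp add: residual_def regs_step_def Let_def residual_regs_gamma)

text \<open>
  The two summands are orthogonal: the first is orthogonal to the \<open>i\<close>-th row of \<open>X\<close>, the second
  is a multiple of its conjugate.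
\<close>

lemma err_step:
  "err (regs_step X y j i s) =
     row_projection X i *v err s + row_component X i (fst (regs_step X y j i s) - L)"
proof -
  obtain \<beta> z where s: "s = (\<beta>, z)" by force
  define \<beta>' where "\<beta>' = \<beta> + regs_gamma X y j \<beta>"
  \<comment> \<open>Expressing the argument of the projection through \<open>err s\<close> makes the
    new \<open>z\<close> a projection of a difference; subtracting it from \<open>\<beta>'\<close>
    yields both summands.\<close>
  have "z + regs_gamma X y j \<beta> = (\<beta>' - L) - err s"
    by (simp add: \<beta>'_def err_def s)
  then have "regs_step X y j i s = (\<beta>', row_projection X i *v ((\<beta>' - L) - err s))"
    by (simp only: regs_step_def s Let_def prod.case \<beta>'_def)
  moreover have "row_projection X i *v ((\<beta>' - L) - err s)
      = (\<beta>' - L) - row_component X i (\<beta>' - L) - row_projection X i *v err s"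
    by (simp only: matrix_vector_mult_diff_distrib[of _ "\<beta>' - L" "err s"]
        row_projection_mult[of X i "\<beta>' - L"])
  ultimately show ?thesis
    by (simp add: err_def[of "(_, _)"])
qed

text \<open>The initial error is \<open>- L\<close>, and both summands of a step stay in the row
  space. Contraction by \<open>\<alpha>\<close> is only available there.\<close>

lemma err_in_row_space: "s \<in> set_pmf (regs X y t) \<Longrightarrow> err s \<in> row_space X"
proof (induction t arbitrary: s)
  case 0
  then show ?case
    using subspace_neg[OF subspace_row_space L_row_space] by (simp add: err_def)
next
  case (Suc t)
  then obtain s0 j i where "s0 \<in> set_pmf (regs X y t)" "s = regs_step X y j i s0"
    by auto
  then show ?case
    using Suc.IH by (simp add: err_step row_projection_in_row_space subspace_add[OF subspace_row_space])
qed

lemma expectation_column_residual: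
  "measure_pmf.expectation (column_pmf X)
     (\<lambda>j. (norm (row_projection (conj_transpose X) j *v r))\<^sup>2) \<le> \<alpha> * (norm r)\<^sup>2"
proof -
  have "conj_transpose X \<noteq> 0"
    using frobenius_pos frobenius_norm_conj_transpose[of X] by (auto simp: frobenius_norm_def)
  then show ?thesis
    using contraction_residual[of r]
    by (simp add: column_pmf_eq expectation_norm_row_projection frobenius_norm_conj_transpose)
qed

lemma expectation_kernel_residual:
  "measure_pmf.expectation (regs_kernel X y s) (\<lambda>s'. (norm (residual s'))\<^sup>2)
     \<le> \<alpha> * (norm (residual s))\<^sup>2"
  using expectation_column_residual by (simp add: expectation_regs_kernel residual_step)

lemma expectation_kernel_err:
  assumes "err s \<in> row_space X"
  shows "measure_pmf.expectation (regs_kernel X y s) (\<lambda>s'. (norm (err s'))\<^sup>2)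
    \<le> \<alpha> * (norm (err s))\<^sup>2 + \<alpha> * (norm (residual s))\<^sup>2 / (frobenius_norm X)\<^sup>2"
proof -
  have "measure_pmf.expectation (row_pmf X) (\<lambda>i. (norm (err (regs_step X y j i s)))\<^sup>2)
      = (norm (err s))\<^sup>2 - (norm (X *v err s))\<^sup>2 / (frobenius_norm X)\<^sup>2
        + (norm (row_projection (conj_transpose X) j *v residual s))\<^sup>2 / (frobenius_norm X)\<^sup>2" for j
  proof -
    have fst: "fst (regs_step X y j i s) = fst s + regs_gamma X y j (fst s)" for i
      by (cases s) (simp add: regs_step_def Let_def)
    \<comment> \<open>Since \<open>X *v L = y\<close>, the image of \<open>\<beta> - L\<close> after
      the column step is the new residual. It depends on \<open>j\<close> alone, so the row average
      is taken with it fixed.\<close>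
    have "X *v (fst s + regs_gamma X y j (fst s) - L)
        = row_projection (conj_transpose X) j *v residual s"
      by (simp only: matrix_vector_mult_diff_distrib[of X] X_L residual_regs_gamma residual_def)
    then show ?thesis
      by (simp add: err_step fst expectation_norm_row_projection_plus_row_component[OF X_nonzero])
  qed
  then have "measure_pmf.expectation (regs_kernel X y s) (\<lambda>s'. (norm (err s'))\<^sup>2)
      = (norm (err s))\<^sup>2 - (norm (X *v err s))\<^sup>2 / (frobenius_norm X)\<^sup>2
        + measure_pmf.expectation (column_pmf X)
            (\<lambda>j. (norm (row_projection (conj_transpose X) j *v residual s))\<^sup>2) / (frobenius_norm X)\<^sup>2"
    by (simp add: expectation_regs_kernel integrable_measure_pmf_finite)
  also have "\<dots> \<le> \<alpha> * (norm (err s))\<^sup>2 + \<alpha> * (norm (residual s))\<^sup>2 / (frobenius_norm X)\<^sup>2"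
    by (intro add_mono contraction_row_space[OF assms] divide_right_mono expectation_column_residual) simp
  finally show ?thesis .
qed

lemma expectation_regs_mono:
  fixes f g :: "_ \<Rightarrow> real"
  assumes "\<And>s. s \<in> set_pmf (regs X y t) \<Longrightarrow> f s \<le> g s"
  shows "measure_pmf.expectation (regs X y t) f \<le> measure_pmf.expectation (regs X y t) g"
  using assms
  by (intro integral_mono_AE integrable_measure_pmf_finite finite_set_regs) (simp add: AE_measure_pmf_iff)

lemma expectation_residual:
  "measure_pmf.expectation (regs X y t) (\<lambda>s. (norm (residual s))\<^sup>2) \<le> \<alpha> ^ t * (norm y)\<^sup>2"
proof (induction t)
  case (Suc t)
  have "measure_pmf.expectation (regs X y (Suc t)) (\<lambda>s. (norm (residual s))\<^sup>2)
      \<le> measure_pmf.expectation (regs X y t) (\<lambda>s. \<alpha> * (norm (residual s))\<^sup>2)"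
    unfolding expectation_regs_Suc by (intro expectation_regs_mono expectation_kernel_residual)
  also have "\<dots> \<le> \<alpha> * (\<alpha> ^ t * (norm y)\<^sup>2)"
    using Suc.IH \<alpha>_nonneg by (simp add: mult_left_mono)
  finally show ?case
    by (simp add: mult.assoc)
qed (simp add: residual_def)

lemma expectation_err:
  "measure_pmf.expectation (regs X y t) (\<lambda>s. (norm (err s))\<^sup>2)
     \<le> \<alpha> ^ t * (norm L)\<^sup>2 + real t * \<alpha> ^ t * ((norm y)\<^sup>2 / (frobenius_norm X)\<^sup>2)"
proof (induction t)
  case (Suc t)
  let ?E = "measure_pmf.expectation (regs X y t)"
  let ?F = "(frobenius_norm X)\<^sup>2"
  have "measure_pmf.expectation (regs X y (Suc t)) (\<lambda>s. (norm (err s))\<^sup>2)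
      \<le> ?E (\<lambda>s. \<alpha> * (norm (err s))\<^sup>2 + \<alpha> * (norm (residual s))\<^sup>2 / ?F)"
    unfolding expectation_regs_Suc
    by (intro expectation_regs_mono expectation_kernel_err err_in_row_space)
  also have "\<dots> = \<alpha> * ?E (\<lambda>s. (norm (err s))\<^sup>2) + \<alpha> * ?E (\<lambda>s. (norm (residual s))\<^sup>2) / ?F"
    by (simp add: integrable_measure_pmf_finite finite_set_regs)
  also have "\<dots> \<le> \<alpha> * (\<alpha> ^ t * (norm L)\<^sup>2 + real t * \<alpha> ^ t * ((norm y)\<^sup>2 / ?F))
      + \<alpha> * (\<alpha> ^ t * (norm y)\<^sup>2) / ?F"
    using \<alpha>_nonneg
    by (intro add_mono mult_left_mono divide_right_mono Suc.IH expectation_residual) simp_all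
  \<comment> \<open>The fresh residual term has the same size \<open>\<alpha> ^ Suc t\<close> as
    each of the \<open>t\<close> earlier ones after their further shrinking, which turns
    \<open>t\<close> into \<open>Suc t\<close>.\<close>
  also have "\<dots> = \<alpha> ^ Suc t * (norm L)\<^sup>2 + real (Suc t) * \<alpha> ^ Suc t * ((norm y)\<^sup>2 / ?F)"
    by (simp add: algebra_simps)
  finally show ?case .
qed (simp add: err_def)

end

section \<open>Geometric comparison and the final bound\<close>

text \<open>Split \<open>a ^ n\<close> into \<open>a ^ (n div 2) * a ^ k\<close>. The first factor
  is kept; the second absorbs \<open>n \<le> 2 * k\<close>, since each of the \<open>k\<close> terms
  \<open>a ^ i\<close> with \<open>i < k\<close> is at least \<open>a ^ k\<close>.\<close>

lemma mult_power_le_geometric: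
  fixes a :: real
  assumes "0 \<le> a" "a < 1"
  shows "real n * a ^ n \<le> 2 * a ^ (n div 2) / (1 - a)"
proof -
  define k where "k = n - n div 2"
  have n: "n = n div 2 + k" "n \<le> 2 * k"
    by (auto simp: k_def)
  have "real k * a ^ k = (\<Sum>i<k. a ^ k)"
    by simp
  also have "\<dots> \<le> (\<Sum>i<k. a ^ i)"
    using assms by (intro sum_mono power_decreasing) auto
  also have "\<dots> = (1 - a ^ k) / (1 - a)"
    using assms by (simp add: sum_gp_strict)
  also have "\<dots> \<le> 1 / (1 - a)"
    using assms by (intro divide_right_mono) simp_all
  finally have k: "real k * a ^ k \<le> 1 / (1 - a)" .
  have "real n * a ^ n \<le> (2 * real k) * a ^ n"
    using n(2) assms by (intro mult_right_mono) simp_all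
  also have "\<dots> = 2 * a ^ (n div 2) * (real k * a ^ k)"
    by (subst n(1)) (simp only: power_add mult_ac)
  also have "\<dots> \<le> 2 * a ^ (n div 2) * (1 / (1 - a))"
    using k assms by (intro mult_left_mono) simp_all
  finally show ?thesis by simp
qed

theorem theorem4p1:
  fixes X :: "complex ^ 'n ^ 'm" and y :: "complex ^ 'm" and T :: nat
    and \<beta>LN :: "complex ^ 'n" and B \<alpha> :: real
  assumes "CARD('m) < CARD('n)"
    and "full_row_rank X"
    and "T \<ge> 1"
  defines "\<beta>LN \<equiv> least_norm_solution X y"
    and "B \<equiv> (norm (X *v \<beta>LN))\<^sup>2 / (frobenius_norm X)\<^sup>2"
    and "\<alpha> \<equiv> 1 - (sigma_min X)\<^sup>2 / (frobenius_norm X)\<^sup>2"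
  shows "measure_pmf.expectation (regs_output X y T) (\<lambda>b. (norm (b - \<beta>LN))\<^sup>2)
           \<le> \<alpha> ^ T * (norm \<beta>LN)\<^sup>2 + 2 * \<alpha> ^ (T div 2) * (B / (1 - \<alpha>))"
proof -
  interpret R: regs_analysis X y
    by standard (rule assms(2))
  have \<alpha>: "\<alpha> = R.\<alpha>" and L: "\<beta>LN = R.L"
    by (simp_all add: \<alpha>_def R.\<alpha>_def \<beta>LN_def R.L_def)
  have B: "B = (norm y)\<^sup>2 / (frobenius_norm X)\<^sup>2"
    by (simp add: B_def L R.X_L)
  have "measure_pmf.expectation (regs_output X y T) (\<lambda>b. (norm (b - \<beta>LN))\<^sup>2)
      = measure_pmf.expectation (regs X y T) (\<lambda>s. (norm (R.err s))\<^sup>2)"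
    by (simp add: regs_output_def case_prod_beta R.err_def L)
  also have "\<dots> \<le> \<alpha> ^ T * (norm \<beta>LN)\<^sup>2 + (real T * \<alpha> ^ T) * B"
    using R.expectation_err[of T] by (simp add: \<alpha> L B)
  also have "\<dots> \<le> \<alpha> ^ T * (norm \<beta>LN)\<^sup>2 + (2 * \<alpha> ^ (T div 2) / (1 - \<alpha>)) * B"
    unfolding \<alpha> by (intro add_left_mono mult_right_mono mult_power_le_geometric R.\<alpha>_nonneg R.\<alpha>_less_1)
      (simp add: B)
  finally show ?thesis by simp
qed

end
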